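(* Let $Y$ be a locally compact space with a Radon measure $\mu$, let $\langle\mathfrak V,\mathfrak Q;X,Y\rangle$ be a $(\Theta,\mathcal E,\mu)$-structure with $\mathfrak V=\langle\langle\mathfrak E,\tau\rangle,\pi,X,\{\nu_j:j\in J\}\rangle$, $\mathfrak Q=\langle\langle\mathfrak H,\gamma\rangle,\xi,X,\mathfrak Y\rangle$, and let $\langle\mathfrak V;\mathfrak Z,\mathsf H\rangle$ be $\mu$-related, where $\mathfrak Z=\langle\langle\mathfrak T,\delta\rangle,\zeta,X,\mathfrak K\rangle$ and $\mathsf H_x=\mathfrak H_x$ for all $x\in X$. If $\Gamma(\xi)\bigstar\mathcal E(\Theta)\subseteq\Gamma(\zeta)$, then for all $x\in X$ $$\Gamma_\diamond^x(\xi)_{peq}\bigstar\Gamma^x_{\mathcal E(\Theta)}(\pi)\subseteq\Gamma_\diamond^x(\zeta).$$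
   Context: Vector spaces are over $\mathbb C$; Hlcs means Hausdorff locally convex space. Bundles. A bundle of $\Omega$-spaces $\langle\langle\mathfrak E,\tau\rangle,\pi,X,\mathfrak N\rangle$ (Gierz) consists of topological spaces $\langle\mathfrak E,\tau\rangle$ and $X$, a continuous open surjection $\pi:\mathfrak E\to X$, a vector space structure on each stalk $\mathfrak E_x=\pi^{-1}(x)$ such that addition $\{(a,b):\pi(a)=\pi(b)\}\to\mathfrak E$ and scalar multiplication are continuous, and a set $\mathfrak N=\{\nu_j:j\in J\}$ of functions $\mathfrak E\to[0,\infty[$ whose restrictions to each $\mathfrak E_x$ form a directed family of seminorms generating the (Hausdorff) topology induced by $\tau$ on $\mathfrak E_x$. For $U\subseteq X$, $\prod^b_{x\in U}\mathfrak E_x$ is the set of $\sigma\in\prod_{x\in U}\mathfrak E_x$ with $\sup_{x\in U}\nu_j(\sigma(x))<\infty$ for all $j$; $\Gamma_U(\pi)$ (resp. $\Gamma_U^x(\pi)$) is the set of those continuous (resp. continuous at $x\in U$); $U$ is omitted if $U=X$. The tubes $\{\beta:\pi(\beta)\in U,\nu_j(\beta-\sigma(\pi(\beta)))<\varepsilon\}$ ($U$ open, $\sigma\in\Gamma_U(\pi)$, $\varepsilon>0$, $j\in J$) form a base of $\tau$. For a set $S$ of sections, $\Gamma_S^x(\pi)=\{H\in\Gamma^x(\pi):\exists F\in S,\ H(x)=F(x)\}$; $\Gamma^x_\diamond(\pi)=\Gamma^x_{\Gamma(\pi)}(\pi)$; similarly for $\xi,\zeta$. $\mathfrak L_1(Y,E,\mu)$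 ($E$ a Hlcs): scalarly essentially $\mu$-integrable maps $Y\to E$ whose (weak) integral belongs to $E$ (Bourbaki); $Meas(Y,E,\mu)$: $\mu$-measurable maps; $\int^\bullet$: essential upper integral. $(\Theta,\mathcal E,\mu)$-structure. Let $\mathcal E\subseteq\Gamma(\pi)$, $\Theta\subseteq\prod_xBounded(\mathfrak E_x)$, $\mathsf D(B,\mathcal E)=\mathcal E\cap\prod_xB(x)$, $\mathcal B_B^x=\{v(x):v\in\mathsf D(B,\mathcal E)\}$, $S_x=\{\mathcal B_B^x:B\in\Theta\}$, $\mathcal E(\Theta)=\bigcup_B\mathsf D(B,\mathcal E)$; $\mathcal L_{S_x}(\mathfrak E_x)$: continuous linear endomorphisms with uniform convergence on members of $S_x$. $\langle\mathfrak V,\mathfrak Q;X,Y\rangle$ is a $(\Theta,\mathcal E,\mu)$-structure if all $\mathsf D(B,\mathcal E)\ne\emptyset$, $\bigcup_B\mathcal B_B^x$ is total in $\mathfrak E_x$ for all $x$, and $\mathfrak Q$ is a bundle of $\Omega$-spaces with $\mathfrak H_x\subseteq\mathfrak L_1(Y,\mathcal L_{S_x}(\mathfrak E_x),\mu)$ and directed family of seminorms $\sup_{(t,j,B)\in O}P^x_{(t,j,B)}$, $O$ finite $\subset Y\times J\times\Theta$, $P^x_{(t,j,B)}(F)=\sup_{v\in\mathsf D(B,\mathcal E)}\nu_j(F(t)v(x))$. For a set $A\subseteq\prod_x\mathfrak H_x$, $A_{peq}$ is the set of pointwise equicontinuous $F\in A$: for every $t\in Y$ and $j\in J$ there are $a>0$,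 $j_1\in J$ with $\nu_j(F(z)(t)v_z)\le a\,\nu_{j_1}(v_z)$ for all $z\in X$, $v_z\in\mathfrak E_z$. $(F\bigstar v)(x)(s)=F(x)(s)(v(x))$ for $F\in\prod_x\mathcal L(\mathfrak E_x)^Y$, $v\in\prod_x\mathfrak E_x$. $\langle\mathfrak V;\mathfrak Z\rangle$ is $\mu$-related if $\mathfrak Z$ is a bundle of $\Omega$-spaces with $\mathfrak T_x\subseteq Meas(Y,\mathfrak E_x,\mu)\cap\mathfrak L_1(Y,\mathfrak E_x,\mu)$ and directed family of seminorms $f\mapsto\sup_{(s,j)\in O}\nu_j(f(s))$, $O$ finite $\subset Y\times J$; every $H\in\Gamma(\zeta)$ satisfies $\int^\bullet_Y\sup_x\nu_j(H(x)(s))\,d|\mu|(s)<\infty$ for all $j$; and $x\mapsto\int H(x)(s)d\mu(s)$ belongs to $\Gamma(\pi)$ for all $H\in\Gamma(\zeta)$. $\langle\mathfrak V;\mathfrak Z,\mathsf H\rangle$ is $\mu$-related if moreover $\mathsf H_x\subseteq\mathcal L(\mathfrak E_x)^Y$ for all $x$ and $(\prod_x\mathsf H_x)\bigstar(\prod_x\mathfrak E_x)\subseteq\prod_x\mathfrak T_x$. *)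

theory Defs
  imports "HOL-Analysis.Analysis"
begin

section \<open>Complex vector spaces on a carrier, with a topology\<close>

text \<open>Stalks of a bundle are subsets of the total space, so vector spaces carry an explicit
  carrier set. Functions with a given domain are \<^const>\<open>extensional\<close> on that domain.\<close>

record 'a tvs =
  carr :: "'a set"
  vadd :: "'a \<Rightarrow> 'a \<Rightarrow> 'a"
  vscl :: "complex \<Rightarrow> 'a \<Rightarrow> 'a"
  vtop :: "'a topology"

definition vsub :: "'a tvs \<Rightarrow> 'a \<Rightarrow> 'a \<Rightarrow> 'a" where
  "vsub E a b = vadd E a (vscl E (-1) b)"

definition complex_vector_space :: "'a tvs \<Rightarrow> bool" where
  "complex_vector_space E \<longleftrightarrow>
     (\<forall>a\<in>carr E. \<forall>b\<in>carr E. vadd E a b \<in> carr E) \<and>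
     (\<forall>c. \<forall>a\<in>carr E. vscl E c a \<in> carr E) \<and>
     (\<forall>a\<in>carr E. \<forall>b\<in>carr E. \<forall>d\<in>carr E. vadd E (vadd E a b) d = vadd E a (vadd E b d)) \<and>
     (\<forall>a\<in>carr E. \<forall>b\<in>carr E. vadd E a b = vadd E b a) \<and>
     (\<exists>z\<in>carr E. (\<forall>a\<in>carr E. vadd E z a = a) \<and> (\<forall>a\<in>carr E. \<exists>b\<in>carr E. vadd E a b = z)) \<and>
     (\<forall>c. \<forall>a\<in>carr E. \<forall>b\<in>carr E. vscl E c (vadd E a b) = vadd E (vscl E c a) (vscl E c b)) \<and>
     (\<forall>c d. \<forall>a\<in>carr E. vscl E (c + d) a = vadd E (vscl E c a) (vscl E d a)) \<and>
     (\<forall>c d. \<forall>a\<in>carr E. vscl E (c * d) a = vscl E c (vscl E d a)) \<and>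
     (\<forall>a\<in>carr E. vscl E 1 a = a)"

definition seminorm_on :: "'a tvs \<Rightarrow> ('a \<Rightarrow> real) \<Rightarrow> bool" where
  "seminorm_on E p \<longleftrightarrow>
     (\<forall>a\<in>carr E. 0 \<le> p a) \<and>
     (\<forall>a\<in>carr E. \<forall>b\<in>carr E. p (vadd E a b) \<le> p a + p b) \<and>
     (\<forall>c. \<forall>a\<in>carr E. p (vscl E c a) = cmod c * p a)"

definition directed_on :: "'a tvs \<Rightarrow> 'j set \<Rightarrow> ('j \<Rightarrow> 'a \<Rightarrow> real) \<Rightarrow> bool" where
  "directed_on E J p \<longleftrightarrow>
     (\<forall>i\<in>J. \<forall>j\<in>J. \<exists>k\<in>J. \<forall>a\<in>carr E. p i a \<le> p k a \<and> p j a \<le> p k a)"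

text \<open>The vector space topology generated by the seminorms \<open>p j\<close>, \<open>j \<in> J\<close>. It depends only on
  the algebraic part of \<open>E\<close>.\<close>

definition seminorm_topology :: "'a tvs \<Rightarrow> 'j set \<Rightarrow> ('j \<Rightarrow> 'a \<Rightarrow> real) \<Rightarrow> 'a topology" where
  "seminorm_topology E J p = topology_generated_by
     (insert (carr E)
       {{b \<in> carr E. p j (vsub E b a) < \<epsilon>} | a j \<epsilon>. a \<in> carr E \<and> j \<in> J \<and> 0 < \<epsilon>})"

definition linear_span :: "'a tvs \<Rightarrow> 'a set \<Rightarrow> 'a set" where
  "linear_span E A = \<Inter>{W. A \<subseteq> W \<and> W \<subseteq> carr E \<and> W \<noteq> {} \<and>
     (\<forall>a\<in>W. \<forall>b\<in>W. vadd E a b \<in> W) \<and> (\<forall>c. \<forall>a\<in>W. vscl E c a \<in> W)}"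

definition total_in :: "'a tvs \<Rightarrow> 'a set \<Rightarrow> bool" where
  "total_in E A \<longleftrightarrow> A \<subseteq> carr E \<and> vtop E closure_of linear_span E A = carr E"

definition dual :: "'a tvs \<Rightarrow> ('a \<Rightarrow> complex) set" where
  "dual E = {\<phi>. (\<forall>a\<in>carr E. \<forall>b\<in>carr E. \<phi> (vadd E a b) = \<phi> a + \<phi> b) \<and>
                (\<forall>c. \<forall>a\<in>carr E. \<phi> (vscl E c a) = c * \<phi> a) \<and>
                continuous_map (vtop E) euclidean \<phi>}"

definition cont_endos :: "'a tvs \<Rightarrow> ('a \<Rightarrow> 'a) set" where
  "cont_endos E = {A \<in> carr E \<rightarrow>\<^sub>E carr E.
     (\<forall>a\<in>carr E. \<forall>b\<in>carr E. A (vadd E a b) = vadd E (A a) (A b)) \<and>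
     (\<forall>c. \<forall>a\<in>carr E. A (vscl E c a) = vscl E c (A a)) \<and>
     continuous_map (vtop E) (vtop E) A}"

definition endo_add :: "'a tvs \<Rightarrow> ('a \<Rightarrow> 'a) \<Rightarrow> ('a \<Rightarrow> 'a) \<Rightarrow> 'a \<Rightarrow> 'a" where
  "endo_add E A C = (\<lambda>w\<in>carr E. vadd E (A w) (C w))"

definition endo_scl :: "'a tvs \<Rightarrow> complex \<Rightarrow> ('a \<Rightarrow> 'a) \<Rightarrow> 'a \<Rightarrow> 'a" where
  "endo_scl E c A = (\<lambda>w\<in>carr E. vscl E c (A w))"

text \<open>\<open>L\<^sub>S(E)\<close>: continuous endomorphisms with the topology of uniform convergence on the members
  of \<open>S\<close>, where the topology of \<open>E\<close> is generated by the seminorms \<open>p j\<close>, \<open>j \<in> J\<close>. It is meant for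
  a set \<open>S\<close> of nonempty bounded sets; the suprema are then finite.\<close>

definition endo_tvs ::
  "'a tvs \<Rightarrow> 'j set \<Rightarrow> ('j \<Rightarrow> 'a \<Rightarrow> real) \<Rightarrow> 'a set set \<Rightarrow> ('a \<Rightarrow> 'a) tvs" where
  "endo_tvs E J p S =
     \<lparr>carr = cont_endos E, vadd = endo_add E, vscl = endo_scl E,
      vtop = seminorm_topology
        \<lparr>carr = cont_endos E, vadd = endo_add E, vscl = endo_scl E, vtop = undefined\<rparr>
        (S \<times> J) (\<lambda>(W, j) A. SUP w\<in>W. p j (A w))\<rparr>"


section \<open>Integration with respect to a complex Radon measure\<close>

text \<open>Following Bourbaki, a Radon measure on a locally compact space \<open>Y\<close> is a linear form on the
  space of continuous functions with compact support, continuous in the inductive limit topology.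
  Compactly supported functions are set to 0 outside \<open>topspace Y\<close>.\<close>

definition supported_in :: "'y topology \<Rightarrow> 'y set \<Rightarrow> ('y \<Rightarrow> 'b::real_normed_vector) set" where
  "supported_in Y K = {f. continuous_map Y euclidean f \<and> (\<forall>y. y \<notin> K \<longrightarrow> f y = 0)}"

definition compact_supp :: "'y topology \<Rightarrow> ('y \<Rightarrow> 'b::real_normed_vector) set" where
  "compact_supp Y = (\<Union>K\<in>{K. compactin Y K}. supported_in Y K)"

definition radon_measure :: "'y topology \<Rightarrow> (('y \<Rightarrow> complex) \<Rightarrow> complex) \<Rightarrow> bool" where
  "radon_measure Y \<mu> \<longleftrightarrow>
     (\<forall>f\<in>compact_supp Y. \<forall>g\<in>compact_supp Y. \<mu> (\<lambda>y. f y + g y) = \<mu> f + \<mu> g) \<and>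
     (\<forall>c. \<forall>f\<in>compact_supp Y. \<mu> (\<lambda>y. c * f y) = c * \<mu> f) \<and>
     (\<forall>K. compactin Y K \<longrightarrow>
        (\<exists>M. \<forall>f\<in>supported_in Y K. cmod (\<mu> f) \<le> M * (SUP y. cmod (f y))))"

text \<open>The value of \<open>|\<mu>|\<close> on a nonnegative compactly supported function.\<close>

definition abs_radon :: "'y topology \<Rightarrow> (('y \<Rightarrow> complex) \<Rightarrow> complex) \<Rightarrow> ('y \<Rightarrow> real) \<Rightarrow> ennreal" where
  "abs_radon Y \<mu> g =
     (SUP h\<in>{h \<in> compact_supp Y. \<forall>y. cmod (h y) \<le> g y}. ennreal (cmod (\<mu> h)))"

definition lower_semicont :: "'y topology \<Rightarrow> ('y \<Rightarrow> ennreal) \<Rightarrow> bool" where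
  "lower_semicont Y f \<longleftrightarrow> (\<forall>a. openin Y {y \<in> topspace Y. a < f y})"

definition upper_integral_lsc ::
  "'y topology \<Rightarrow> (('y \<Rightarrow> complex) \<Rightarrow> complex) \<Rightarrow> ('y \<Rightarrow> ennreal) \<Rightarrow> ennreal" where
  "upper_integral_lsc Y \<mu> f =
     (SUP g\<in>{g \<in> compact_supp Y. (\<forall>y. 0 \<le> g y) \<and> (\<forall>y\<in>topspace Y. ennreal (g y) \<le> f y)}.
        abs_radon Y \<mu> g)"

text \<open>The upper integral and the essential upper integral with respect to \<open>|\<mu>|\<close>.\<close>

definition upper_integral ::
  "'y topology \<Rightarrow> (('y \<Rightarrow> complex) \<Rightarrow> complex) \<Rightarrow> ('y \<Rightarrow> ennreal) \<Rightarrow> ennreal" where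
  "upper_integral Y \<mu> f =
     (INF h\<in>{h. lower_semicont Y h \<and> (\<forall>y\<in>topspace Y. f y \<le> h y)}. upper_integral_lsc Y \<mu> h)"

definition ess_upper_integral ::
  "'y topology \<Rightarrow> (('y \<Rightarrow> complex) \<Rightarrow> complex) \<Rightarrow> ('y \<Rightarrow> ennreal) \<Rightarrow> ennreal" where
  "ess_upper_integral Y \<mu> f =
     (SUP K\<in>{K. compactin Y K}. upper_integral Y \<mu> (\<lambda>y. f y * indicator K y))"

definition negligible_for :: "'y topology \<Rightarrow> (('y \<Rightarrow> complex) \<Rightarrow> complex) \<Rightarrow> 'y set \<Rightarrow> bool" where
  "negligible_for Y \<mu> N \<longleftrightarrow> N \<subseteq> topspace Y \<and> upper_integral Y \<mu> (indicator N) = 0"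

definition locally_negligible_for ::
  "'y topology \<Rightarrow> (('y \<Rightarrow> complex) \<Rightarrow> complex) \<Rightarrow> 'y set \<Rightarrow> bool" where
  "locally_negligible_for Y \<mu> N \<longleftrightarrow>
     N \<subseteq> topspace Y \<and> (\<forall>K. compactin Y K \<longrightarrow> negligible_for Y \<mu> (N \<inter> K))"

text \<open>\<open>f\<close> lies in the closure of the compactly supported continuous functions for the seminorm
  \<open>f \<mapsto> |\<mu>|\<^sup>*(|f|)\<close>, and \<open>I\<close> is the value at \<open>f\<close> of the continuous extension of \<open>\<mu>\<close>.\<close>

definition has_radon_integral ::
  "'y topology \<Rightarrow> (('y \<Rightarrow> complex) \<Rightarrow> complex) \<Rightarrow> ('y \<Rightarrow> complex) \<Rightarrow> complex \<Rightarrow> bool" where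
  "has_radon_integral Y \<mu> f I \<longleftrightarrow>
     (\<forall>\<epsilon>>0. \<exists>g\<in>compact_supp Y.
        upper_integral Y \<mu> (\<lambda>y. ennreal (cmod (f y - g y))) < ennreal \<epsilon> \<and> cmod (\<mu> g - I) < \<epsilon>)"

definition has_ess_integral ::
  "'y topology \<Rightarrow> (('y \<Rightarrow> complex) \<Rightarrow> complex) \<Rightarrow> ('y \<Rightarrow> complex) \<Rightarrow> complex \<Rightarrow> bool" where
  "has_ess_integral Y \<mu> f I \<longleftrightarrow>
     (\<exists>g. has_radon_integral Y \<mu> g I \<and> locally_negligible_for Y \<mu> {y \<in> topspace Y. f y \<noteq> g y})"

definition scalarly_ess_integrable ::
  "'y topology \<Rightarrow> (('y \<Rightarrow> complex) \<Rightarrow> complex) \<Rightarrow> 'a tvs \<Rightarrow> ('y \<Rightarrow> 'a) \<Rightarrow> bool" where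
  "scalarly_ess_integrable Y \<mu> E f \<longleftrightarrow>
     (\<forall>\<phi>\<in>dual E. \<exists>I. has_ess_integral Y \<mu> (\<lambda>s. \<phi> (f s)) I)"

definition has_weak_integral ::
  "'y topology \<Rightarrow> (('y \<Rightarrow> complex) \<Rightarrow> complex) \<Rightarrow> 'a tvs \<Rightarrow> ('y \<Rightarrow> 'a) \<Rightarrow> 'a \<Rightarrow> bool" where
  "has_weak_integral Y \<mu> E f e \<longleftrightarrow>
     e \<in> carr E \<and> (\<forall>\<phi>\<in>dual E. has_ess_integral Y \<mu> (\<lambda>s. \<phi> (f s)) (\<phi> e))"

definition weak_integral ::
  "'y topology \<Rightarrow> (('y \<Rightarrow> complex) \<Rightarrow> complex) \<Rightarrow> 'a tvs \<Rightarrow> ('y \<Rightarrow> 'a) \<Rightarrow> 'a" where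
  "weak_integral Y \<mu> E f = (THE e. has_weak_integral Y \<mu> E f e)"

definition L1 :: "'y topology \<Rightarrow> 'a tvs \<Rightarrow> (('y \<Rightarrow> complex) \<Rightarrow> complex) \<Rightarrow> ('y \<Rightarrow> 'a) set" where
  "L1 Y E \<mu> = {f \<in> topspace Y \<rightarrow>\<^sub>E carr E.
     scalarly_ess_integrable Y \<mu> E f \<and> (\<exists>e. has_weak_integral Y \<mu> E f e)}"

definition Meas :: "'y topology \<Rightarrow> 'a tvs \<Rightarrow> (('y \<Rightarrow> complex) \<Rightarrow> complex) \<Rightarrow> ('y \<Rightarrow> 'a) set" where
  "Meas Y E \<mu> = {f \<in> topspace Y \<rightarrow>\<^sub>E carr E.
     \<forall>K. compactin Y K \<longrightarrow>
       (\<exists>N (C :: nat \<Rightarrow> 'y set). N \<subseteq> K \<and> negligible_for Y \<mu> N \<and>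
          disjoint_family C \<and> (\<Union>n. C n) = K - N \<and>
          (\<forall>n. compactin Y (C n) \<and> continuous_map (subtopology Y (C n)) (vtop E) f))}"


section \<open>Bundles of \<open>\<Omega>\<close>-spaces\<close>

record ('x, 'e, 'j) vbundle =
  tot :: "'e topology"
  bas :: "'x topology"
  proj :: "'e \<Rightarrow> 'x"
  badd :: "'e \<Rightarrow> 'e \<Rightarrow> 'e"
  bscl :: "complex \<Rightarrow> 'e \<Rightarrow> 'e"
  idx :: "'j set"
  nu :: "'j \<Rightarrow> 'e \<Rightarrow> real"

abbreviation pts :: "('x, 'e, 'j) vbundle \<Rightarrow> 'x set" where
  "pts V \<equiv> topspace (bas V)"

definition stalk :: "('x, 'e, 'j) vbundle \<Rightarrow> 'x \<Rightarrow> 'e set" where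
  "stalk V x = {a \<in> topspace (tot V). proj V a = x}"

definition stalk_tvs :: "('x, 'e, 'j) vbundle \<Rightarrow> 'x \<Rightarrow> 'e tvs" where
  "stalk_tvs V x = \<lparr>carr = stalk V x, vadd = badd V, vscl = bscl V,
                    vtop = subtopology (tot V) (stalk V x)\<rparr>"

definition bounded_sections :: "('x, 'e, 'j) vbundle \<Rightarrow> 'x set \<Rightarrow> ('x \<Rightarrow> 'e) set" where
  "bounded_sections V U = {\<sigma> \<in> \<Pi>\<^sub>E x\<in>U. stalk V x.
     \<forall>j\<in>idx V. bdd_above ((\<lambda>x. nu V j (\<sigma> x)) ` U)}"

definition sections_on :: "('x, 'e, 'j) vbundle \<Rightarrow> 'x set \<Rightarrow> ('x \<Rightarrow> 'e) set" where
  "sections_on V U = {\<sigma> \<in> bounded_sections V U. continuous_map (subtopology (bas V) U) (tot V) \<sigma>}"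

definition sections_on_at :: "('x, 'e, 'j) vbundle \<Rightarrow> 'x set \<Rightarrow> 'x \<Rightarrow> ('x \<Rightarrow> 'e) set" where
  "sections_on_at V U x =
     {\<sigma> \<in> bounded_sections V U. topcontinuous_at (subtopology (bas V) U) (tot V) \<sigma> x}"

abbreviation sections :: "('x, 'e, 'j) vbundle \<Rightarrow> ('x \<Rightarrow> 'e) set" where
  "sections V \<equiv> sections_on V (pts V)"

abbreviation sections_at :: "('x, 'e, 'j) vbundle \<Rightarrow> 'x \<Rightarrow> ('x \<Rightarrow> 'e) set" where
  "sections_at V x \<equiv> sections_on_at V (pts V) x"

text \<open>\<open>sections_at_through V S x\<close> is \<open>\<Gamma>\<^sub>S\<^sup>x\<close>, and \<open>sections_diamond V x\<close> is the case \<open>S = \<Gamma>\<close>.\<close>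

definition sections_at_through ::
  "('x, 'e, 'j) vbundle \<Rightarrow> ('x \<Rightarrow> 'e) set \<Rightarrow> 'x \<Rightarrow> ('x \<Rightarrow> 'e) set" where
  "sections_at_through V S x = {H \<in> sections_at V x. \<exists>F\<in>S. H x = F x}"

definition sections_diamond :: "('x, 'e, 'j) vbundle \<Rightarrow> 'x \<Rightarrow> ('x \<Rightarrow> 'e) set" where
  "sections_diamond V x = sections_at_through V (sections V) x"

definition tube :: "('x, 'e, 'j) vbundle \<Rightarrow> 'x set \<Rightarrow> ('x \<Rightarrow> 'e) \<Rightarrow> real \<Rightarrow> 'j \<Rightarrow> 'e set" where
  "tube V U \<sigma> \<epsilon> j = {\<beta> \<in> topspace (tot V). proj V \<beta> \<in> U \<and>
     nu V j (vsub (stalk_tvs V (proj V \<beta>)) \<beta> (\<sigma> (proj V \<beta>))) < \<epsilon>}"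

text \<open>The last clause says that the tubes form a base of the topology of the total space.\<close>

definition omega_bundle :: "('x, 'e, 'j) vbundle \<Rightarrow> bool" where
  "omega_bundle V \<longleftrightarrow>
     continuous_map (tot V) (bas V) (proj V) \<and>
     open_map (tot V) (bas V) (proj V) \<and>
     proj V ` topspace (tot V) = pts V \<and>
     (\<forall>x\<in>pts V. complex_vector_space (stalk_tvs V x)) \<and>
     continuous_map (subtopology (prod_topology (tot V) (tot V)) {(a, b). proj V a = proj V b})
       (tot V) (\<lambda>(a, b). badd V a b) \<and>
     continuous_map (prod_topology euclidean (tot V)) (tot V) (\<lambda>(c, a). bscl V c a) \<and>
     (\<forall>x\<in>pts V. (\<forall>j\<in>idx V. seminorm_on (stalk_tvs V x) (nu V j)) \<and>
        directed_on (stalk_tvs V x) (idx V) (nu V) \<and>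
        vtop (stalk_tvs V x) = seminorm_topology (stalk_tvs V x) (idx V) (nu V) \<and>
        Hausdorff_space (vtop (stalk_tvs V x))) \<and>
     openin (tot V) = arbitrary union_of
       (\<lambda>W. \<exists>U \<sigma> \<epsilon> j. openin (bas V) U \<and> \<sigma> \<in> sections_on V U \<and> 0 < \<epsilon> \<and> j \<in> idx V \<and>
                       W = tube V U \<sigma> \<epsilon> j)"

definition bounded_sets :: "('x, 'e, 'j) vbundle \<Rightarrow> 'x \<Rightarrow> 'e set set" where
  "bounded_sets V x = {A. A \<subseteq> stalk V x \<and> (\<forall>j\<in>idx V. bdd_above (nu V j ` A))}"


section \<open>\<open>(\<Theta>, \<E>, \<mu>)\<close>-structures\<close>

definition sel :: "('x, 'e, 'j) vbundle \<Rightarrow> ('x \<Rightarrow> 'e) set \<Rightarrow> ('x \<Rightarrow> 'e set) \<Rightarrow> ('x \<Rightarrow> 'e) set" where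
  "sel V \<E> B = \<E> \<inter> (\<Pi>\<^sub>E x\<in>pts V. B x)"

definition sel_vals :: "('x, 'e, 'j) vbundle \<Rightarrow> ('x \<Rightarrow> 'e) set \<Rightarrow> ('x \<Rightarrow> 'e set) \<Rightarrow> 'x \<Rightarrow> 'e set" where
  "sel_vals V \<E> B x = (\<lambda>v. v x) ` sel V \<E> B"

definition sel_all ::
  "('x, 'e, 'j) vbundle \<Rightarrow> ('x \<Rightarrow> 'e) set \<Rightarrow> ('x \<Rightarrow> 'e set) set \<Rightarrow> ('x \<Rightarrow> 'e) set" where
  "sel_all V \<E> \<Theta> = (\<Union>B\<in>\<Theta>. sel V \<E> B)"

text \<open>\<open>\<L>\<^bsub>S\<^sub>x\<^esub>(\<EE>\<^sub>x)\<close> with \<open>S\<^sub>x = {sel_vals V \<E> B x | B \<in> \<Theta>}\<close>.\<close>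

definition stalk_endos ::
  "('x, 'e, 'j) vbundle \<Rightarrow> ('x \<Rightarrow> 'e) set \<Rightarrow> ('x \<Rightarrow> 'e set) set \<Rightarrow> 'x \<Rightarrow> ('e \<Rightarrow> 'e) tvs" where
  "stalk_endos V \<E> \<Theta> x =
     endo_tvs (stalk_tvs V x) (idx V) (nu V) ((\<lambda>B. sel_vals V \<E> B x) ` \<Theta>)"

definition Pseminorm ::
  "('x, 'e, 'j) vbundle \<Rightarrow> ('x \<Rightarrow> 'e) set \<Rightarrow> 'x \<Rightarrow> 'y \<times> 'j \<times> ('x \<Rightarrow> 'e set) \<Rightarrow> ('y \<Rightarrow> 'e \<Rightarrow> 'e) \<Rightarrow> real"
  where
  "Pseminorm V \<E> x = (\<lambda>(t, j, B) F. SUP v\<in>sel V \<E> B. nu V j (F t (v x)))"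

text \<open>The total space of \<open>Q\<close> consists of the maps themselves, i.e. its stalk over \<open>x\<close> is a set of
  maps from \<open>topspace Y\<close> to the extensional endomorphisms of the stalk of \<open>V\<close> over \<open>x\<close>. Such maps
  for distinct \<open>x\<close> are distinct if \<open>Y\<close> is nonempty. The supremum over the empty set \<open>Op\<close> of
  indices is 0.\<close>

definition theta_structure ::
  "('x, 'e, 'j) vbundle \<Rightarrow>
   ('x, 'y \<Rightarrow> 'e \<Rightarrow> 'e, ('y \<times> 'j \<times> ('x \<Rightarrow> 'e set)) set) vbundle \<Rightarrow>
   'y topology \<Rightarrow> ('x \<Rightarrow> 'e set) set \<Rightarrow> ('x \<Rightarrow> 'e) set \<Rightarrow> (('y \<Rightarrow> complex) \<Rightarrow> complex) \<Rightarrow> bool" where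
  "theta_structure V Q Y \<Theta> \<E> \<mu> \<longleftrightarrow>
     omega_bundle V \<and>
     \<E> \<subseteq> sections V \<and>
     \<Theta> \<subseteq> (\<Pi>\<^sub>E x\<in>pts V. bounded_sets V x) \<and>
     (\<forall>B\<in>\<Theta>. sel V \<E> B \<noteq> {}) \<and>
     (\<forall>x\<in>pts V. total_in (stalk_tvs V x) (\<Union>B\<in>\<Theta>. sel_vals V \<E> B x)) \<and>
     omega_bundle Q \<and>
     bas Q = bas V \<and>
     (\<forall>x\<in>pts V. stalk Q x \<subseteq> L1 Y (stalk_endos V \<E> \<Theta> x) \<mu>) \<and>
     (\<forall>x\<in>pts V. \<forall>F\<in>stalk Q x. \<forall>G\<in>stalk Q x.
        badd Q F G = (\<lambda>t\<in>topspace Y. endo_add (stalk_tvs V x) (F t) (G t))) \<and>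
     (\<forall>x\<in>pts V. \<forall>F\<in>stalk Q x. \<forall>c.
        bscl Q c F = (\<lambda>t\<in>topspace Y. endo_scl (stalk_tvs V x) c (F t))) \<and>
     idx Q = {Op. finite Op \<and> Op \<subseteq> topspace Y \<times> idx V \<times> \<Theta>} \<and>
     (\<forall>x\<in>pts V. \<forall>F\<in>stalk Q x. \<forall>Op\<in>idx Q.
        nu Q Op F = Max (insert 0 ((\<lambda>i. Pseminorm V \<E> x i F) ` Op)))"

definition pointwise_equicontinuous ::
  "('x, 'e, 'j) vbundle \<Rightarrow> 'y topology \<Rightarrow> ('x \<Rightarrow> 'y \<Rightarrow> 'e \<Rightarrow> 'e) set \<Rightarrow> ('x \<Rightarrow> 'y \<Rightarrow> 'e \<Rightarrow> 'e) set" where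
  "pointwise_equicontinuous V Y A = {F \<in> A.
     \<forall>t\<in>topspace Y. \<forall>j\<in>idx V. \<exists>a>0. \<exists>j1\<in>idx V.
       \<forall>z\<in>pts V. \<forall>w\<in>stalk V z. nu V j (F z t w) \<le> a * nu V j1 w}"


section \<open>\<open>\<mu>\<close>-related bundles\<close>

definition star ::
  "('x, 'e, 'j) vbundle \<Rightarrow> 'y topology \<Rightarrow> ('x \<Rightarrow> 'y \<Rightarrow> 'e \<Rightarrow> 'e) \<Rightarrow> ('x \<Rightarrow> 'e) \<Rightarrow> 'x \<Rightarrow> 'y \<Rightarrow> 'e" where
  "star V Y F v = (\<lambda>x\<in>pts V. \<lambda>s\<in>topspace Y. F x s (v x))"

definition star_set ::
  "('x, 'e, 'j) vbundle \<Rightarrow> 'y topology \<Rightarrow> ('x \<Rightarrow> 'y \<Rightarrow> 'e \<Rightarrow> 'e) set \<Rightarrow> ('x \<Rightarrow> 'e) set \<Rightarrow>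
   ('x \<Rightarrow> 'y \<Rightarrow> 'e) set" where
  "star_set V Y A S = {star V Y F v | F v. F \<in> A \<and> v \<in> S}"

definition mu_related ::
  "('x, 'e, 'j) vbundle \<Rightarrow> ('x, 'y \<Rightarrow> 'e, ('y \<times> 'j) set) vbundle \<Rightarrow>
   'y topology \<Rightarrow> (('y \<Rightarrow> complex) \<Rightarrow> complex) \<Rightarrow> bool" where
  "mu_related V Z Y \<mu> \<longleftrightarrow>
     omega_bundle V \<and>
     omega_bundle Z \<and>
     bas Z = bas V \<and>
     (\<forall>x\<in>pts V. stalk Z x \<subseteq> Meas Y (stalk_tvs V x) \<mu> \<inter> L1 Y (stalk_tvs V x) \<mu>) \<and>
     (\<forall>x\<in>pts V. \<forall>f\<in>stalk Z x. \<forall>g\<in>stalk Z x.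
        badd Z f g = (\<lambda>s\<in>topspace Y. badd V (f s) (g s))) \<and>
     (\<forall>x\<in>pts V. \<forall>f\<in>stalk Z x. \<forall>c. bscl Z c f = (\<lambda>s\<in>topspace Y. bscl V c (f s))) \<and>
     idx Z = {Op. finite Op \<and> Op \<subseteq> topspace Y \<times> idx V} \<and>
     (\<forall>x\<in>pts V. \<forall>f\<in>stalk Z x. \<forall>Op\<in>idx Z.
        nu Z Op f = Max (insert 0 ((\<lambda>(s, j). nu V j (f s)) ` Op))) \<and>
     (\<forall>H\<in>sections Z. \<forall>j\<in>idx V.
        ess_upper_integral Y \<mu> (\<lambda>s. SUP x\<in>pts V. ennreal (nu V j (H x s))) < \<infinity>) \<and>
     (\<forall>H\<in>sections Z. (\<lambda>x\<in>pts V. weak_integral Y \<mu> (stalk_tvs V x) (H x)) \<in> sections V)"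

definition mu_related_with ::
  "('x, 'e, 'j) vbundle \<Rightarrow> ('x, 'y \<Rightarrow> 'e, ('y \<times> 'j) set) vbundle \<Rightarrow> ('x \<Rightarrow> ('y \<Rightarrow> 'e \<Rightarrow> 'e) set) \<Rightarrow>
   'y topology \<Rightarrow> (('y \<Rightarrow> complex) \<Rightarrow> complex) \<Rightarrow> bool" where
  "mu_related_with V Z H Y \<mu> \<longleftrightarrow>
     mu_related V Z Y \<mu> \<and>
     (\<forall>x\<in>pts V. H x \<subseteq> (topspace Y \<rightarrow>\<^sub>E cont_endos (stalk_tvs V x))) \<and>
     star_set V Y (\<Pi>\<^sub>E x\<in>pts V. H x) (\<Pi>\<^sub>E x\<in>pts V. stalk V x) \<subseteq> (\<Pi>\<^sub>E x\<in>pts V. stalk Z x)"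

end

theory Submission
  imports Defs
begin

text \<open>Let \<open>F\<close> and \<open>v\<close> be continuous at \<open>x\<close>, and let \<open>F'\<close> and \<open>v'\<close> be global sections with the same
  values at \<open>x\<close>. Since \<open>F' \<bigstar> v'\<close> is a continuous section through \<open>(F \<bigstar> v) x\<close>, it suffices that the
  seminorms of \<open>(F \<bigstar> v) z - (F' \<bigstar> v') z\<close> become small as \<open>z\<close> approaches \<open>x\<close>. This difference is
  \<open>F z s (v z - v' z) + (F z - F' z) s (v' z)\<close>: the first term is controlled by pointwise
  equicontinuity, the second by the seminorm of \<open>F z - F' z\<close> with index \<open>(s, j, B)\<close>, where \<open>v'\<close>
  belongs to \<open>B\<close>.\<close>

section \<open>Vector spaces on a carrier\<close>

lemma vadd_closed:
  "complex_vector_space E \<Longrightarrow> a \<in> carr E \<Longrightarrow> b \<in> carr E \<Longrightarrow> vadd E a b \<in> carr E"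
  by (simp add: complex_vector_space_def)

lemma vscl_closed:
  "complex_vector_space E \<Longrightarrow> a \<in> carr E \<Longrightarrow> vscl E c a \<in> carr E"
  by (simp add: complex_vector_space_def)

lemma vsub_closed:
  "complex_vector_space E \<Longrightarrow> a \<in> carr E \<Longrightarrow> b \<in> carr E \<Longrightarrow> vsub E a b \<in> carr E"
  by (simp add: vsub_def vadd_closed vscl_closed)

lemma vadd_assoc:
  "complex_vector_space E \<Longrightarrow> a \<in> carr E \<Longrightarrow> b \<in> carr E \<Longrightarrow> d \<in> carr E \<Longrightarrow>
   vadd E (vadd E a b) d = vadd E a (vadd E b d)"
  unfolding complex_vector_space_def by blast

lemma vadd_commute:
  "complex_vector_space E \<Longrightarrow> a \<in> carr E \<Longrightarrow> b \<in> carr E \<Longrightarrow> vadd E a b = vadd E b a"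
  by (simp add: complex_vector_space_def)

lemma vscl_one: "complex_vector_space E \<Longrightarrow> a \<in> carr E \<Longrightarrow> vscl E 1 a = a"
  by (simp add: complex_vector_space_def)

lemma vscl_add_left:
  "complex_vector_space E \<Longrightarrow> a \<in> carr E \<Longrightarrow> vscl E (c + d) a = vadd E (vscl E c a) (vscl E d a)"
  by (simp add: complex_vector_space_def)

text \<open>The axioms only assert that a neutral element exists, without naming it. This lemma lets
  \<open>vscl E 0 b\<close>, for any available vector \<open>b\<close>, serve as the zero
  vector.\<close>

lemma vadd_zero_left:
  assumes E: "complex_vector_space E" and a: "a \<in> carr E" and b: "b \<in> carr E"
  shows "vadd E (vscl E 0 b) a = a"
proof -
  have "\<exists>z\<in>carr E. (\<forall>u\<in>carr E. vadd E z u = u) \<and> (\<forall>u\<in>carr E. \<exists>u'\<in>carr E. vadd E u u' = z)"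
    using E by (simp add: complex_vector_space_def)
  then obtain z where z: "z \<in> carr E" "\<And>u. u \<in> carr E \<Longrightarrow> vadd E z u = u"
      "\<And>u. u \<in> carr E \<Longrightarrow> \<exists>u'\<in>carr E. vadd E u u' = z"
    by blast
  define e where "e = vscl E 0 b"
  have e: "e \<in> carr E" using E b by (simp add: e_def vscl_closed)
  have ee: "vadd E e e = e"
    using vscl_add_left[OF E b, of 0 0] by (simp add: e_def)
  obtain e' where e': "e' \<in> carr E" "vadd E e e' = z" using z(3) e by blast
  \<comment> \<open>From \<open>e + e = e\<close>, adding the inverse \<open>e'\<close> cancels one
    summand and leaves the neutral element \<open>z\<close>.\<close>
  have "e = vadd E (vadd E e' e) e"
    using z(2)[OF e] e' vadd_commute[OF E e e'(1)] by simp
  also have "\<dots> = z"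
    using vadd_assoc[OF E e'(1) e e] ee e'(2) vadd_commute[OF E e e'(1)] by simp
  finally show ?thesis using z(2)[OF a] by (simp add: e_def)
qed

lemma vsub_self: "complex_vector_space E \<Longrightarrow> a \<in> carr E \<Longrightarrow> vsub E a a = vscl E 0 a"
  using vscl_add_left[of E a 1 "-1"] by (simp add: vsub_def vscl_one)

lemma vsub_vadd_cancel:
  assumes E: "complex_vector_space E" and a: "a \<in> carr E" and b: "b \<in> carr E"
  shows "vadd E (vsub E a b) b = a"
proof -
  have mb: "vscl E (-1) b \<in> carr E" by (rule vscl_closed[OF E b])
  have "vadd E (vscl E (-1) b) b = vscl E 0 b"
    using vscl_add_left[OF E b, of "-1" 1] vscl_one[OF E b] by simp
  then have "vadd E (vsub E a b) b = vadd E a (vscl E 0 b)"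
    by (simp add: vsub_def vadd_assoc[OF E a mb b])
  also have "\<dots> = a"
    using vadd_zero_left[OF E a b] vadd_commute[OF E a vscl_closed[OF E b]] by simp
  finally show ?thesis .
qed

lemma vadd_vsub_vsub:
  assumes E: "complex_vector_space E"
    and a: "a \<in> carr E" and b: "b \<in> carr E" and c: "c \<in> carr E"
  shows "vadd E (vsub E a b) (vsub E b c) = vsub E a c"
proof -
  have mc: "vscl E (-1) c \<in> carr E" by (rule vscl_closed[OF E c])
  have "vadd E (vsub E a b) (vsub E b c) = vadd E (vadd E (vsub E a b) b) (vscl E (-1) c)"
    unfolding vsub_def[of E b c]
    by (rule vadd_assoc[OF E vsub_closed[OF E a b] b mc, symmetric])
  then show ?thesis by (simp add: vsub_vadd_cancel[OF E a b] vsub_def[of E a c])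
qed

section \<open>Seminorms of differences\<close>

lemma seminorm_nonneg: "seminorm_on E p \<Longrightarrow> a \<in> carr E \<Longrightarrow> 0 \<le> p a"
  by (simp add: seminorm_on_def)

lemma seminorm_vadd:
  "seminorm_on E p \<Longrightarrow> a \<in> carr E \<Longrightarrow> b \<in> carr E \<Longrightarrow> p (vadd E a b) \<le> p a + p b"
  by (simp add: seminorm_on_def)

lemma seminorm_vscl: "seminorm_on E p \<Longrightarrow> a \<in> carr E \<Longrightarrow> p (vscl E c a) = cmod c * p a"
  by (simp add: seminorm_on_def)

lemma seminorm_vsub_triangle:
  assumes "complex_vector_space E" "seminorm_on E p"
    and "a \<in> carr E" "b \<in> carr E" "c \<in> carr E"
  shows "p (vsub E a c) \<le> p (vsub E a b) + p (vsub E b c)"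
  using seminorm_vadd[OF assms(2), of "vsub E a b" "vsub E b c"] assms
  by (simp add: vadd_vsub_vsub vsub_closed)

lemma seminorm_vsub_self:
  "complex_vector_space E \<Longrightarrow> seminorm_on E p \<Longrightarrow> a \<in> carr E \<Longrightarrow> p (vsub E a a) = 0"
  by (simp add: vsub_self seminorm_vscl)

text \<open>The zero vector and its negative have seminorm 0, so the triangle inequality gives both
  estimates. The lemma turns balls centred at zero into conditions on \<open>p a\<close>.\<close>

lemma seminorm_vsub_zero:
  assumes E: "complex_vector_space E" and p: "seminorm_on E p"
    and a: "a \<in> carr E" and b: "b \<in> carr E"
  shows "p (vsub E a (vscl E 0 b)) = p a"
proof (rule antisym)
  have z: "vscl E 0 b \<in> carr E" by (rule vscl_closed[OF E b])
  show "p (vsub E a (vscl E 0 b)) \<le> p a"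
    using seminorm_vadd[OF p a vscl_closed[OF E z, of "-1"]] seminorm_vscl[OF p z]
      seminorm_vscl[OF p b] by (simp add: vsub_def)
  show "p a \<le> p (vsub E a (vscl E 0 b))"
    using seminorm_vadd[OF p vsub_closed[OF E a z] z] vsub_vadd_cancel[OF E a z]
      seminorm_vscl[OF p b] by simp
qed

section \<open>Bundles\<close>

lemma stalk_tvs_simps [simp]:
  "carr (stalk_tvs V x) = stalk V x"
  "vadd (stalk_tvs V x) = badd V"
  "vscl (stalk_tvs V x) = bscl V"
  "vtop (stalk_tvs V x) = subtopology (tot V) (stalk V x)"
  by (simp_all add: stalk_tvs_def)

lemma omega_bundle_complex_vector_space:
  "omega_bundle V \<Longrightarrow> x \<in> pts V \<Longrightarrow> complex_vector_space (stalk_tvs V x)"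
  by (simp add: omega_bundle_def)

lemma omega_bundle_seminorm_on:
  "omega_bundle V \<Longrightarrow> x \<in> pts V \<Longrightarrow> j \<in> idx V \<Longrightarrow> seminorm_on (stalk_tvs V x) (nu V j)"
  by (simp add: omega_bundle_def)

lemma openin_tube:
  assumes "omega_bundle V" "openin (bas V) U" "\<sigma> \<in> sections_on V U" "0 < \<epsilon>" "j \<in> idx V"
  shows "openin (tot V) (tube V U \<sigma> \<epsilon> j)"
proof -
  have "openin (tot V) = arbitrary union_of
       (\<lambda>W. \<exists>U \<sigma> \<epsilon> j. openin (bas V) U \<and> \<sigma> \<in> sections_on V U \<and> 0 < \<epsilon> \<and> j \<in> idx V \<and>
                       W = tube V U \<sigma> \<epsilon> j)"
    using assms(1) by (simp add: omega_bundle_def)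
  then show ?thesis
    using assms(2-) by (metis (mono_tags, lifting) arbitrary_union_of_inc)
qed

lemma openin_contains_tube:
  assumes "omega_bundle V" "openin (tot V) W" "b \<in> W"
  obtains U \<sigma> \<epsilon> j where "openin (bas V) U" "\<sigma> \<in> sections_on V U" "0 < \<epsilon>" "j \<in> idx V"
    "b \<in> tube V U \<sigma> \<epsilon> j" "tube V U \<sigma> \<epsilon> j \<subseteq> W"
proof -
  have "openin (tot V) = arbitrary union_of
       (\<lambda>W. \<exists>U \<sigma> \<epsilon> j. openin (bas V) U \<and> \<sigma> \<in> sections_on V U \<and> 0 < \<epsilon> \<and> j \<in> idx V \<and>
                       W = tube V U \<sigma> \<epsilon> j)"
    using assms(1) by (simp add: omega_bundle_def)
  with assms(2) obtain \<U> where \<U>: "\<U> \<subseteq> Collect (\<lambda>W. \<exists>U \<sigma> \<epsilon> j. openin (bas V) U \<and>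
      \<sigma> \<in> sections_on V U \<and> 0 < \<epsilon> \<and> j \<in> idx V \<and> W = tube V U \<sigma> \<epsilon> j)" "\<Union>\<U> = W"
    unfolding union_of_def by auto
  from \<U>(2) assms(3) obtain T where T: "T \<in> \<U>" "b \<in> T" "T \<subseteq> W" by blast
  from T(1) \<U>(1) obtain U \<sigma> \<epsilon> j where "openin (bas V) U" "\<sigma> \<in> sections_on V U" "0 < \<epsilon>"
      "j \<in> idx V" "T = tube V U \<sigma> \<epsilon> j" by blast
  with T(2,3) that show thesis by blast
qed

section \<open>Tubes and continuity of sections at a point\<close>

lemma sections_on_at_stalk: "\<sigma> \<in> sections_on_at V U x \<Longrightarrow> z \<in> U \<Longrightarrow> \<sigma> z \<in> stalk V z"
  by (auto simp: sections_on_at_def bounded_sections_def)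

lemma sections_on_stalk: "\<sigma> \<in> sections_on V U \<Longrightarrow> z \<in> U \<Longrightarrow> \<sigma> z \<in> stalk V z"
  by (auto simp: sections_on_def bounded_sections_def)

lemma stalk_mem_tube_iff:
  "b \<in> stalk V z \<Longrightarrow>
   b \<in> tube V U \<sigma> \<epsilon> j \<longleftrightarrow> z \<in> U \<and> nu V j (vsub (stalk_tvs V z) b (\<sigma> z)) < \<epsilon>"
  by (auto simp: stalk_def tube_def)

text \<open>The tube of radius \<delta> around \<rho> over the whole base is an open set containing
  \<open>\<rho> x\<close>, which is also \<open>\<sigma> x\<close>. Continuity of \<sigma> at
  \<open>x\<close> pulls it back to a neighbourhood of \<open>x\<close>.\<close>

lemma sections_at_near_section:
  assumes V: "omega_bundle V" and \<sigma>: "\<sigma> \<in> sections_at V x" and \<rho>: "\<rho> \<in> sections V"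
    and x: "x \<in> pts V" and eq: "\<sigma> x = \<rho> x" and \<delta>: "0 < \<delta>" and j: "j \<in> idx V"
  obtains N where "openin (bas V) N" "x \<in> N"
    "\<And>z. z \<in> N \<Longrightarrow> nu V j (vsub (stalk_tvs V z) (\<sigma> z) (\<rho> z)) < \<delta>"
proof -
  let ?T = "tube V (pts V) \<rho> \<delta> j"
  have "openin (tot V) ?T" by (rule openin_tube[OF V _ \<rho> \<delta> j]) simp
  moreover have "\<sigma> x \<in> ?T"
    using sections_on_at_stalk[OF \<sigma> x] x \<delta> eq
      seminorm_vsub_self[OF omega_bundle_complex_vector_space[OF V x]
        omega_bundle_seminorm_on[OF V x j], of "\<sigma> x"]
    by (simp add: stalk_mem_tube_iff)
  ultimately obtain N where N: "openin (bas V) N" "x \<in> N" "\<forall>y\<in>N. \<sigma> y \<in> ?T"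
    using \<sigma> unfolding sections_on_at_def topcontinuous_at_def by auto
  have "nu V j (vsub (stalk_tvs V z) (\<sigma> z) (\<rho> z)) < \<delta>" if "z \<in> N" for z
  proof -
    have "z \<in> pts V" using N(1) that openin_subset by blast
    then show ?thesis using N(3) that sections_on_at_stalk[OF \<sigma>] stalk_mem_tube_iff by fastforce
  qed
  with N that show thesis by blast
qed

text \<open>A basic neighbourhood of \<open>\<sigma> x\<close> is a tube around some local section
  \<tau>, in general unrelated to \<rho>. The continuous section \<rho> enters a narrower tube
  around \<tau> near \<open>x\<close>, and the remaining width absorbs the difference between
  \<sigma> and \<rho>.\<close>

lemma bounded_section_continuous_atI:
  assumes V: "omega_bundle V" and \<sigma>: "\<sigma> \<in> bounded_sections V (pts V)" and \<rho>: "\<rho> \<in> sections V"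
    and x: "x \<in> pts V" and eq: "\<sigma> x = \<rho> x"
    and near: "\<And>j \<eta>. j \<in> idx V \<Longrightarrow> 0 < \<eta> \<Longrightarrow>
      \<exists>N. openin (bas V) N \<and> x \<in> N \<and>
        (\<forall>z\<in>N. nu V j (vsub (stalk_tvs V z) (\<sigma> z) (\<rho> z)) < \<eta>)"
  shows "\<sigma> \<in> sections_at V x"
proof -
  have st: "\<sigma> z \<in> stalk V z" if "z \<in> pts V" for z
    using \<sigma> that by (auto simp: bounded_sections_def)
  have "\<exists>N. openin (bas V) N \<and> x \<in> N \<and> (\<forall>z\<in>N. \<sigma> z \<in> W)"
    if W: "openin (tot V) W" "\<sigma> x \<in> W" for W
  proof -
    obtain U \<tau> \<epsilon> j where U: "openin (bas V) U" and \<tau>: "\<tau> \<in> sections_on V U"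
      and \<epsilon>: "0 < \<epsilon>" and j: "j \<in> idx V" and mem: "\<sigma> x \<in> tube V U \<tau> \<epsilon> j"
      and sub: "tube V U \<tau> \<epsilon> j \<subseteq> W"
      using openin_contains_tube[OF V W] .
    define r where "r = nu V j (vsub (stalk_tvs V x) (\<sigma> x) (\<tau> x))"
    have xU: "x \<in> U" and r: "r < \<epsilon>"
      using mem st[OF x] by (auto simp: stalk_mem_tube_iff r_def)
    have "0 \<le> r"
      unfolding r_def
      by (rule seminorm_nonneg[OF omega_bundle_seminorm_on[OF V x j]
            vsub_closed[OF omega_bundle_complex_vector_space[OF V x]]])
         (use st[OF x] sections_on_stalk[OF \<tau> xU] in simp_all)
    \<comment> \<open>The midpoint of \<open>r\<close> and \<epsilon>: a tube of radius \<epsilon>'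
      still contains \<open>\<rho> x\<close>, and a margin \<open>\<epsilon> - \<epsilon>'\<close>
      is left for the distance from \<sigma> to \<rho>. Positivity of \<epsilon>' makes this tube
      open.\<close>
    define \<epsilon>' where "\<epsilon>' = (r + \<epsilon>) / 2"
    have \<epsilon>': "0 < \<epsilon>'" "r < \<epsilon>'" "\<epsilon>' < \<epsilon>" using r \<epsilon> \<open>0 \<le> r\<close> by (auto simp: \<epsilon>'_def)
    \<comment> \<open>Open as the preimage of a tube under the globally continuous section
      \<rho>.\<close>
    let ?M = "{z \<in> pts V. \<rho> z \<in> tube V U \<tau> \<epsilon>' j}"
    have M: "openin (bas V) ?M"
      using \<rho> openin_tube[OF V U \<tau> \<epsilon>'(1) j]
      by (auto simp: sections_on_def intro: openin_continuous_map_preimage)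
    have xM: "x \<in> ?M"
      using x xU \<epsilon>'(2) sections_on_stalk[OF \<rho> x] eq by (simp add: stalk_mem_tube_iff r_def)
    obtain N where N: "openin (bas V) N" "x \<in> N"
        "\<forall>z\<in>N. nu V j (vsub (stalk_tvs V z) (\<sigma> z) (\<rho> z)) < \<epsilon> - \<epsilon>'"
      using near[OF j, of "\<epsilon> - \<epsilon>'"] \<epsilon>'(3) by auto
    have "\<sigma> z \<in> W" if z: "z \<in> N \<inter> ?M" for z
    proof -
      have zX: "z \<in> pts V" using z by blast
      have \<rho>z: "\<rho> z \<in> stalk V z" by (rule sections_on_stalk[OF \<rho> zX])
      then have zU: "z \<in> U" and "nu V j (vsub (stalk_tvs V z) (\<rho> z) (\<tau> z)) < \<epsilon>'"
        using z by (auto simp: stalk_mem_tube_iff)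
      then have "nu V j (vsub (stalk_tvs V z) (\<sigma> z) (\<tau> z)) < \<epsilon>"
        using seminorm_vsub_triangle[OF omega_bundle_complex_vector_space[OF V zX]
            omega_bundle_seminorm_on[OF V zX j], of "\<sigma> z" "\<rho> z" "\<tau> z"]
          st[OF zX] \<rho>z sections_on_stalk[OF \<tau> zU] N(3) z by fastforce
      then show ?thesis using sub zU st[OF zX] by (auto simp: stalk_mem_tube_iff)
    qed
    moreover have "openin (bas V) (N \<inter> ?M)" using N(1) M by blast
    ultimately show ?thesis using N(2) xM by blast
  qed
  then show ?thesis
    using \<sigma> x st by (auto simp: sections_on_at_def topcontinuous_at_def stalk_def)
qed

text \<open>Without this bound the real supremum in \<^const>\<open>Pseminorm\<close> would be a junk value. As the tubes
  are a base, a neighbourhood of zero in a stalk contains a ball of a single seminorm.\<close>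

lemma cont_endo_bdd_above:
  assumes V: "omega_bundle V" and z: "z \<in> pts V" and A: "A \<in> cont_endos (stalk_tvs V z)"
    and W: "W \<in> bounded_sets V z" and j: "j \<in> idx V"
  shows "bdd_above ((\<lambda>w. nu V j (A w)) ` W)"
proof (cases "W = {}")
  case False
  let ?E = "stalk_tvs V z"
  have E: "complex_vector_space ?E" by (rule omega_bundle_complex_vector_space[OF V z])
  have nj: "seminorm_on ?E (nu V j)" by (rule omega_bundle_seminorm_on[OF V z j])
  have WE: "W \<subseteq> stalk V z" using W by (simp add: bounded_sets_def)
  obtain a where a: "a \<in> stalk V z" using False WE by blast
  \<comment> \<open>The zero vector of the stalk.\<close>
  define \<theta> where "\<theta> = bscl V 0 a"
  have \<theta>: "\<theta> \<in> stalk V z" using vscl_closed[OF E, of a 0] a by (simp add: \<theta>_def)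
  have Acarr: "A w \<in> stalk V z" if "w \<in> stalk V z" for w
    using A that by (auto simp: cont_endos_def)
  \<comment> \<open>The open unit ball of \<open>nu V j\<close>, a generator of the seminorm
    topology, which is the topology induced on the stalk.\<close>
  let ?G = "{b \<in> stalk V z. nu V j (vsub ?E b \<theta>) < 1}"
  have "openin (seminorm_topology ?E (idx V) (nu V)) ?G"
    unfolding seminorm_topology_def
    by (rule topology_generated_by_Basis, rule insertI2)
       (use \<theta> j in \<open>auto intro!: exI[of _ \<theta>] exI[of _ j] exI[of _ "1::real"]\<close>)
  then have G: "openin (vtop ?E) ?G"
    using V z by (simp add: omega_bundle_def)
  have "continuous_map (vtop ?E) (vtop ?E) A" using A by (simp add: cont_endos_def)
  then have "openin (vtop ?E) {w \<in> topspace (vtop ?E). A w \<in> ?G}"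
    using G by (rule openin_continuous_map_preimage)
  \<comment> \<open>The preimage of the ball under \<open>A\<close> is the trace on the stalk of an
    open set of the total space, and the latter is a union of tubes.\<close>
  then obtain T where T: "openin (tot V) T" "{w \<in> topspace (vtop ?E). A w \<in> ?G} = T \<inter> stalk V z"
    by (auto simp: openin_subtopology)
  have A\<theta>: "A \<theta> = bscl V 0 (A a)" using A a by (simp add: cont_endos_def \<theta>_def)
  have "nu V j (vsub ?E (A \<theta>) \<theta>) = 0"
    using seminorm_vsub_zero[OF E nj, of "A \<theta>" a] seminorm_vscl[OF nj, of "A a" 0]
      a Acarr[OF a] Acarr[OF \<theta>] A\<theta> by (simp add: \<theta>_def)
  then have "A \<theta> \<in> ?G" using Acarr[OF \<theta>] by simp
  moreover have "topspace (vtop ?E) = stalk V z" by (auto simp: stalk_def)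
  ultimately have "\<theta> \<in> T" using T(2) \<theta> by blast
  then obtain U \<tau> \<epsilon> k where \<tau>: "\<tau> \<in> sections_on V U" and k: "k \<in> idx V"
    and mem: "\<theta> \<in> tube V U \<tau> \<epsilon> k" and sub: "tube V U \<tau> \<epsilon> k \<subseteq> T"
    using openin_contains_tube[OF V T(1)] by metis
  have nk: "seminorm_on ?E (nu V k)" by (rule omega_bundle_seminorm_on[OF V z k])
  have zU: "z \<in> U" and lt: "nu V k (vsub ?E \<theta> (\<tau> z)) < \<epsilon>"
    using mem \<theta> by (auto simp: stalk_mem_tube_iff)
  \<comment> \<open>The tube contains zero but need not be centred there. The radius left over at
    zero gives a ball of \<open>nu V k\<close> around zero that lies in the tube.\<close>
  define \<delta> where "\<delta> = \<epsilon> - nu V k (vsub ?E \<theta> (\<tau> z))"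
  have \<delta>: "0 < \<delta>" using lt by (simp add: \<delta>_def)
  have small: "nu V j (A w) < 1" if w: "w \<in> stalk V z" "nu V k w < \<delta>" for w
  proof -
    have "nu V k (vsub ?E w (\<tau> z)) < \<epsilon>"
      using seminorm_vsub_triangle[OF E nk, of w \<theta> "\<tau> z"] w \<theta> sections_on_stalk[OF \<tau> zU]
        seminorm_vsub_zero[OF E nk, of w a] a by (simp add: \<theta>_def \<delta>_def)
    then have "w \<in> T" using sub w(1) zU by (auto simp: stalk_mem_tube_iff)
    then have "nu V j (vsub ?E (A w) \<theta>) < 1" using T(2) w(1) by blast
    then show ?thesis
      using seminorm_vsub_zero[OF E nj, of "A w" a] a Acarr[OF w(1)] by (simp add: \<theta>_def)
  qed
  have "bdd_above (nu V k ` W)" using W k by (simp add: bounded_sets_def)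
  then obtain M where M: "\<And>w. w \<in> W \<Longrightarrow> nu V k w \<le> M"
    unfolding bdd_above_def by blast
  \<comment> \<open>Since \<open>W\<close> is nonempty, its upper bound \<open>M\<close> is
    nonnegative.\<close>
  obtain w where "w \<in> W" using False by blast
  then have "0 \<le> nu V k w" "nu V k w \<le> M"
    using seminorm_nonneg[OF nk, of w] WE M by auto
  then have M0: "0 \<le> M" by linarith
  \<comment> \<open>Scaling by \<open>c\<close> moves all of \<open>W\<close> into the \<delta>-ball
    of \<open>nu V k\<close>. The summand 1 covers \<open>M = 0\<close> and makes
    \<open>c * M\<close> strictly smaller than \<delta>.\<close>
  define c where "c = \<delta> / (M + 1)"
  have c: "0 < c" using \<delta> M0 by (simp add: c_def)
  have "nu V j (A w) \<le> 1 / c" if w: "w \<in> W" for w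
  proof -
    have wE: "w \<in> stalk V z" using w WE by blast
    have "c * nu V k w \<le> c * M" using M[OF w] c by simp
    also have "\<dots> < \<delta>" using M0 \<delta> by (simp add: c_def field_simps)
    finally have "nu V k (bscl V (of_real c) w) < \<delta>"
      using seminorm_vscl[OF nk, of w "of_real c"] wE c by simp
    then have "nu V j (A (bscl V (of_real c) w)) < 1"
      using small vscl_closed[OF E, of w "of_real c"] wE by simp
    moreover have "A (bscl V (of_real c) w) = bscl V (of_real c) (A w)"
      using A wE by (simp add: cont_endos_def)
    ultimately have "c * nu V j (A w) < 1"
      using seminorm_vscl[OF nj, of "A w" "of_real c"] Acarr[OF wE] c by simp
    then show ?thesis using c by (simp add: field_simps)
  qed
  then show ?thesis by (auto simp: bdd_above_def)
qed simp

section \<open>The product of sections\<close>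

lemma theta_structureD:
  assumes "theta_structure V Q Y \<Theta> \<E> \<mu>"
  shows "omega_bundle V" and "\<E> \<subseteq> sections V"
    and "\<Theta> \<subseteq> (\<Pi>\<^sub>E x\<in>pts V. bounded_sets V x)"
    and "omega_bundle Q" and "bas Q = bas V"
    and "\<forall>x\<in>pts V. \<forall>F\<in>stalk Q x. \<forall>G\<in>stalk Q x.
        badd Q F G = (\<lambda>t\<in>topspace Y. endo_add (stalk_tvs V x) (F t) (G t))"
    and "\<forall>x\<in>pts V. \<forall>F\<in>stalk Q x. \<forall>c.
        bscl Q c F = (\<lambda>t\<in>topspace Y. endo_scl (stalk_tvs V x) c (F t))"
    and "idx Q = {Op. finite Op \<and> Op \<subseteq> topspace Y \<times> idx V \<times> \<Theta>}"
    and "\<forall>x\<in>pts V. \<forall>F\<in>stalk Q x. \<forall>Op\<in>idx Q.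
        nu Q Op F = Max (insert 0 ((\<lambda>i. Pseminorm V \<E> x i F) ` Op))"
  using assms unfolding theta_structure_def by - (elim conjE, assumption)+

lemma mu_relatedD:
  assumes "mu_related V Z Y \<mu>"
  shows "omega_bundle Z" and "bas Z = bas V"
    and "\<forall>x\<in>pts V. \<forall>f\<in>stalk Z x. \<forall>g\<in>stalk Z x.
        badd Z f g = (\<lambda>s\<in>topspace Y. badd V (f s) (g s))"
    and "\<forall>x\<in>pts V. \<forall>f\<in>stalk Z x. \<forall>c. bscl Z c f = (\<lambda>s\<in>topspace Y. bscl V c (f s))"
    and "idx Z = {Op. finite Op \<and> Op \<subseteq> topspace Y \<times> idx V}"
    and "\<forall>x\<in>pts V. \<forall>f\<in>stalk Z x. \<forall>Op\<in>idx Z.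
        nu Z Op f = Max (insert 0 ((\<lambda>(s, j). nu V j (f s)) ` Op))"
  using assms unfolding mu_related_def by - (elim conjE, assumption)+

section \<open>Pointwise evaluation of differences and of seminorms\<close>

lemma theta_structure_vsub_apply:
  assumes \<Theta>: "theta_structure V Q Y \<Theta> \<E> \<mu>" and z: "z \<in> pts V"
    and F: "F \<in> stalk Q z" and G: "G \<in> stalk Q z" and t: "t \<in> topspace Y" and w: "w \<in> stalk V z"
  shows "vsub (stalk_tvs Q z) F G t w = vsub (stalk_tvs V z) (F t w) (G t w)"
proof -
  have "complex_vector_space (stalk_tvs Q z)"
    using omega_bundle_complex_vector_space[OF theta_structureD(4)[OF \<Theta>]] theta_structureD(5)[OF \<Theta>] z
    by simp
  \<comment> \<open>The operations of \<open>Q\<close> are prescribed only on its stalks, so the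
    negative must be known to lie there before the formula for the sum applies.\<close>
  then have "bscl Q (-1) G \<in> stalk Q z"
    using vscl_closed[of "stalk_tvs Q z" G "-1"] G by simp
  then have "badd Q F (bscl Q (-1) G) =
      (\<lambda>t\<in>topspace Y. endo_add (stalk_tvs V z) (F t) (bscl Q (-1) G t))"
    using theta_structureD(6)[OF \<Theta>] z F by blast
  moreover have "bscl Q (-1) G = (\<lambda>t\<in>topspace Y. endo_scl (stalk_tvs V z) (-1) (G t))"
    using theta_structureD(7)[OF \<Theta>] z G by blast
  ultimately show ?thesis
    using t w by (simp add: vsub_def endo_add_def endo_scl_def)
qed

lemma mu_related_vsub_apply:
  assumes \<mu>: "mu_related V Z Y \<mu>" and z: "z \<in> pts V"
    and f: "f \<in> stalk Z z" and g: "g \<in> stalk Z z" and s: "s \<in> topspace Y"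
  shows "vsub (stalk_tvs Z z) f g s = vsub (stalk_tvs V z) (f s) (g s)"
proof -
  have "complex_vector_space (stalk_tvs Z z)"
    using omega_bundle_complex_vector_space[OF mu_relatedD(1)[OF \<mu>]] mu_relatedD(2)[OF \<mu>] z
    by simp
  then have "bscl Z (-1) g \<in> stalk Z z"
    using vscl_closed[of "stalk_tvs Z z" g "-1"] g by simp
  then have "badd Z f (bscl Z (-1) g) = (\<lambda>s\<in>topspace Y. badd V (f s) (bscl Z (-1) g s))"
    using mu_relatedD(3)[OF \<mu>] z f by blast
  moreover have "bscl Z (-1) g = (\<lambda>s\<in>topspace Y. bscl V (-1) (g s))"
    using mu_relatedD(4)[OF \<mu>] z g by blast
  ultimately show ?thesis using s by (simp add: vsub_def)
qed

text \<open>For the singleton index the seminorm of \<open>Q\<close> dominates the supremum over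
  \<open>sel V \<E> B\<close>, and the left side is one of the values in that supremum.\<close>

lemma theta_structure_nu_apply_le:
  assumes \<Theta>: "theta_structure V Q Y \<Theta> \<E> \<mu>" and z: "z \<in> pts V"
    and F: "F \<in> stalk Q z" and Ft: "F t \<in> cont_endos (stalk_tvs V z)"
    and t: "t \<in> topspace Y" and j: "j \<in> idx V" and B: "B \<in> \<Theta>" and v: "v \<in> sel V \<E> B"
  shows "nu V j (F t (v z)) \<le> nu Q {(t, j, B)} F"
proof -
  have V: "omega_bundle V" by (rule theta_structureD(1)[OF \<Theta>])
  have Bz: "B z \<in> bounded_sets V z" using theta_structureD(3)[OF \<Theta>] B z by auto
  \<comment> \<open>Selections have values in \<open>B z\<close>, which is bounded, so the
    continuity of \<open>F t\<close> keeps the supremum finite.\<close>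
  have "(\<lambda>u. nu V j (F t (u z))) ` sel V \<E> B \<subseteq> (\<lambda>w. nu V j (F t w)) ` B z"
    using z by (auto simp: sel_def)
  then have "bdd_above ((\<lambda>u. nu V j (F t (u z))) ` sel V \<E> B)"
    using cont_endo_bdd_above[OF V z Ft Bz j] by (rule bdd_above_mono[rotated])
  then have "nu V j (F t (v z)) \<le> Pseminorm V \<E> z (t, j, B) F"
    using v unfolding Pseminorm_def by (auto intro: cSUP_upper)
  also have "\<dots> \<le> nu Q {(t, j, B)} F"
  proof -
    have "{(t, j, B)} \<in> idx Q" using theta_structureD(8)[OF \<Theta>] t j B by simp
    then have "nu Q {(t, j, B)} F = Max (insert 0 ((\<lambda>i. Pseminorm V \<E> z i F) ` {(t, j, B)}))"
      using theta_structureD(9)[OF \<Theta>] z F by blast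
    then show ?thesis by simp
  qed
  finally show ?thesis .
qed

text \<open>The constants \<open>a\<close> and \<open>j1\<close> are the same at every point of the
  base, so nearness of \<open>v\<close> to \<open>v'\<close> survives application of the varying
  maps \<open>F z s\<close>. Nearness of \<open>F\<close> to \<open>F'\<close> is measured in
  \<open>Q\<close>, with an index adapted to \<open>v'\<close>.\<close>

lemma pointwise_equicontinuous_star_near:
  assumes \<Theta>: "theta_structure V Q Y \<Theta> \<E> \<mu>" and x: "x \<in> pts V"
    and endos: "\<And>z. z \<in> pts V \<Longrightarrow> stalk Q z \<subseteq> (topspace Y \<rightarrow>\<^sub>E cont_endos (stalk_tvs V z))"
    and F: "F \<in> pointwise_equicontinuous V Y (sections_at Q x)"
    and F': "F' \<in> sections Q" and FF': "F x = F' x"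
    and v: "v \<in> sections_at V x" and B: "B \<in> \<Theta>" and v': "v' \<in> sel V \<E> B" and vv': "v x = v' x"
    and s: "s \<in> topspace Y" and j: "j \<in> idx V" and \<eta>: "0 < \<eta>"
  shows "\<exists>N. openin (bas V) N \<and> x \<in> N \<and>
    (\<forall>z\<in>N. nu V j (vsub (stalk_tvs V z) (F z s (v z)) (F' z s (v' z))) < \<eta>)"
proof -
  note V = theta_structureD(1)[OF \<Theta>] and Q = theta_structureD(4)[OF \<Theta>]
    and bQ = theta_structureD(5)[OF \<Theta>]
  have v'sec: "v' \<in> sections V" using theta_structureD(2)[OF \<Theta>] v' by (auto simp: sel_def)
  have Fat: "F \<in> sections_at Q x" using F by (simp add: pointwise_equicontinuous_def)
  obtain a j1 where a: "0 < a" and j1: "j1 \<in> idx V"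
    and le: "\<And>z w. z \<in> pts V \<Longrightarrow> w \<in> stalk V z \<Longrightarrow> nu V j (F z s w) \<le> a * nu V j1 w"
    using F s j unfolding pointwise_equicontinuous_def by blast
  have i: "{(s, j, B)} \<in> idx Q" using theta_structureD(8)[OF \<Theta>] s j B by simp
  \<comment> \<open>The factor \<open>a\<close> of the equicontinuity bound turns
    \<open>\<eta> / (2 * a)\<close> into half of \<eta>.\<close>
  obtain N1 where N1: "openin (bas V) N1" "x \<in> N1"
      "\<And>z. z \<in> N1 \<Longrightarrow> nu V j1 (vsub (stalk_tvs V z) (v z) (v' z)) < \<eta> / (2 * a)"
    using sections_at_near_section[OF V v v'sec x vv' _ j1, of "\<eta> / (2 * a)"] \<eta> a by auto
  obtain N2 where N2: "openin (bas V) N2" "x \<in> N2"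
      "\<And>z. z \<in> N2 \<Longrightarrow> nu Q {(s, j, B)} (vsub (stalk_tvs Q z) (F z) (F' z)) < \<eta> / 2"
    using sections_at_near_section[OF Q Fat F' _ FF' _ i, of "\<eta> / 2"] \<eta> x bQ by auto
  have "nu V j (vsub (stalk_tvs V z) (F z s (v z)) (F' z s (v' z))) < \<eta>" if z: "z \<in> N1 \<inter> N2" for z
  proof -
    let ?E = "stalk_tvs V z"
    have zX: "z \<in> pts V" using N1(1) z openin_subset by blast
    have E: "complex_vector_space ?E" by (rule omega_bundle_complex_vector_space[OF V zX])
    have nj: "seminorm_on ?E (nu V j)" by (rule omega_bundle_seminorm_on[OF V zX j])
    have Fz: "F z \<in> stalk Q z" and F'z: "F' z \<in> stalk Q z"
      using sections_on_at_stalk[OF Fat] sections_on_stalk[OF F'] zX bQ by auto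
    have vz: "v z \<in> stalk V z" and v'z: "v' z \<in> stalk V z"
      using sections_on_at_stalk[OF v zX] sections_on_stalk[OF v'sec zX] .
    have endo: "G s \<in> cont_endos ?E" if "G \<in> stalk Q z" for G
      using endos[OF zX] that s by auto
    have carr: "G s w \<in> stalk V z" if "G \<in> stalk Q z" "w \<in> stalk V z" for G w
      using endo[OF that(1)] that(2) by (auto simp: cont_endos_def)
    have "complex_vector_space (stalk_tvs Q z)"
      using omega_bundle_complex_vector_space[OF Q] zX bQ by simp
    then have D: "vsub (stalk_tvs Q z) (F z) (F' z) \<in> stalk Q z"
      using vsub_closed[of "stalk_tvs Q z" "F z" "F' z"] Fz F'z by simp
    have m: "bscl V (-1) (v' z) \<in> stalk V z" using vscl_closed[OF E, of "v' z"] v'z by simp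
    have "vsub ?E (F z s (v z)) (F z s (v' z)) = F z s (vsub ?E (v z) (v' z))"
      using endo[OF Fz] vz v'z m by (simp add: cont_endos_def vsub_def)
    then have "nu V j (vsub ?E (F z s (v z)) (F z s (v' z))) \<le> a * nu V j1 (vsub ?E (v z) (v' z))"
      using le[OF zX, of "vsub ?E (v z) (v' z)"] vsub_closed[OF E] vz v'z by simp
    also have "\<dots> < \<eta> / 2"
      using N1(3)[of z] z a by (simp add: field_simps)
    finally have 1: "nu V j (vsub ?E (F z s (v z)) (F z s (v' z))) < \<eta> / 2" .
    \<comment> \<open>The difference of \<open>F z\<close> and \<open>F' z\<close> is itself an
      element of the stalk of \<open>Q\<close>, so the seminorm estimate for families of
      endomorphisms applies to it.\<close>
    have "nu V j (vsub ?E (F z s (v' z)) (F' z s (v' z)))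
        \<le> nu Q {(s, j, B)} (vsub (stalk_tvs Q z) (F z) (F' z))"
      using theta_structure_nu_apply_le[OF \<Theta> zX D endo[OF D] s j B v']
      by (simp add: theta_structure_vsub_apply[OF \<Theta> zX Fz F'z s v'z])
    also have "\<dots> < \<eta> / 2" using N2(3) z by blast
    \<comment> \<open>Triangle inequality through the intermediate value
      \<open>F z s (v' z)\<close>.\<close>
    finally show ?thesis
      using 1 seminorm_vsub_triangle[OF E nj, of "F z s (v z)" "F z s (v' z)" "F' z s (v' z)"]
        carr Fz F'z vz v'z by simp
  qed
  moreover have "openin (bas V) (N1 \<inter> N2)" using N1(1) N2(1) by blast
  ultimately show ?thesis using N1(2) N2(2) by blast
qed

section \<open>Boundedness of the product section and its continuity at the point\<close>

theorem lemma3p3p12: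
  fixes V :: "('x, 'e, 'j) vbundle"
    and Q :: "('x, 'y \<Rightarrow> 'e \<Rightarrow> 'e, ('y \<times> 'j \<times> ('x \<Rightarrow> 'e set)) set) vbundle"
    and Z :: "('x, 'y \<Rightarrow> 'e, ('y \<times> 'j) set) vbundle"
    and H :: "'x \<Rightarrow> ('y \<Rightarrow> 'e \<Rightarrow> 'e) set"
    and Y :: "'y topology"
    and \<mu> :: "('y \<Rightarrow> complex) \<Rightarrow> complex"
    and \<Theta> :: "('x \<Rightarrow> 'e set) set"
    and \<E> :: "('x \<Rightarrow> 'e) set"
  assumes "locally_compact_space Y" and "Hausdorff_space Y"
    and "radon_measure Y \<mu>"
    and "theta_structure V Q Y \<Theta> \<E> \<mu>"
    and "mu_related_with V Z H Y \<mu>"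
    and "\<forall>x\<in>topspace (bas V). H x = stalk Q x"
    and "star_set V Y (sections Q) (sel_all V \<E> \<Theta>) \<subseteq> sections Z"
  shows "\<forall>x\<in>topspace (bas V).
    star_set V Y
      (pointwise_equicontinuous V Y (sections_diamond Q x))
      (sections_at_through V (sel_all V \<E> \<Theta>) x)
    \<subseteq> sections_diamond Z x"
proof (intro ballI subsetI)
  fix x G
  assume x: "x \<in> pts V"
    and "G \<in> star_set V Y (pointwise_equicontinuous V Y (sections_diamond Q x))
      (sections_at_through V (sel_all V \<E> \<Theta>) x)"
  then obtain F v where G: "G = star V Y F v"
    and Fd: "F \<in> pointwise_equicontinuous V Y (sections_diamond Q x)"
    and vt: "v \<in> sections_at_through V (sel_all V \<E> \<Theta>) x"
    unfolding star_set_def by blast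
  note \<Theta> = assms(4)
  have \<mu>: "mu_related V Z Y \<mu>" using assms(5) by (simp add: mu_related_with_def)
  note Z = mu_relatedD(1)[OF \<mu>] and bZ = mu_relatedD(2)[OF \<mu>] and bQ = theta_structureD(5)[OF \<Theta>]
  note idxZ = mu_relatedD(5)[OF \<mu>]
  have endos: "stalk Q z \<subseteq> (topspace Y \<rightarrow>\<^sub>E cont_endos (stalk_tvs V z))" if "z \<in> pts V" for z
    using assms(5,6) that unfolding mu_related_with_def by auto
  obtain F' where F': "F' \<in> sections Q" "F x = F' x"
    using Fd by (auto simp: pointwise_equicontinuous_def sections_diamond_def sections_at_through_def)
  \<comment> \<open>The equicontinuity condition concerns \<open>F\<close> alone, so it persists in
    the larger set of sections continuous at \<open>x\<close>.\<close>
  have Fp: "F \<in> pointwise_equicontinuous V Y (sections_at Q x)"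
    using Fd by (auto simp: pointwise_equicontinuous_def sections_diamond_def sections_at_through_def)
  then have Fat: "F \<in> sections_at Q x" by (simp add: pointwise_equicontinuous_def)
  obtain v' B where v: "v \<in> sections_at V x" and v': "v' \<in> sel V \<E> B" "B \<in> \<Theta>" "v x = v' x"
    using vt by (auto simp: sections_at_through_def sel_all_def)
  \<comment> \<open>The comparison section: it is continuous everywhere by the inclusion assumed for
    global sections, and it agrees with \<open>G\<close> at \<open>x\<close>.\<close>
  define G' where "G' = star V Y F' v'"
  have G'sec: "G' \<in> sections Z"
    using assms(7) F'(1) v' unfolding G'_def star_set_def sel_all_def by blast
  have eq: "G x = G' x" using F'(2) v'(3) by (simp add: G G'_def star_def)
  have "F \<in> (\<Pi>\<^sub>E x\<in>pts V. stalk Q x)" and v_Pi: "v \<in> (\<Pi>\<^sub>E x\<in>pts V. stalk V x)"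
    using Fat v bQ by (simp_all add: sections_on_at_def bounded_sections_def)
  moreover have "(\<Pi>\<^sub>E x\<in>pts V. stalk Q x) = (\<Pi>\<^sub>E x\<in>pts V. H x)"
    using assms(6) by (intro PiE_cong) simp
  ultimately have "G \<in> star_set V Y (\<Pi>\<^sub>E x\<in>pts V. H x) (\<Pi>\<^sub>E x\<in>pts V. stalk V x)"
    using v_Pi unfolding star_set_def G by blast
  moreover have "star_set V Y (\<Pi>\<^sub>E x\<in>pts V. H x) (\<Pi>\<^sub>E x\<in>pts V. stalk V x)
      \<subseteq> (\<Pi>\<^sub>E x\<in>pts V. stalk Z x)"
    using assms(5) unfolding mu_related_with_def by (elim conjE)
  ultimately have GPi: "G \<in> (\<Pi>\<^sub>E x\<in>pts V. stalk Z x)" by (rule rev_subsetD)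
  have nuZ: "nu Z Op f = Max (insert 0 ((\<lambda>(s, j). nu V j (f s)) ` Op))"
    if "z \<in> pts V" "f \<in> stalk Z z" "Op \<in> idx Z" for z f Op
    using mu_relatedD(6)[OF \<mu>] that by blast
  \<comment> \<open>Equicontinuity bounds each component of \<open>G\<close> by a constant times a
    seminorm of \<open>v\<close>, which is bounded over the base. Finiteness of \<open>Op\<close>
    combines these bounds.\<close>
  have "bdd_above ((\<lambda>z. nu Z Op (G z)) ` pts V)" if Op: "Op \<in> idx Z" for Op
  proof -
    have fin: "finite Op" and Op_sub: "Op \<subseteq> topspace Y \<times> idx V" using Op idxZ by simp_all
    have "\<exists>M. \<forall>z\<in>pts V. nu V (snd i) (G z (fst i)) \<le> M" if "i \<in> Op" for i
    proof -
      obtain s j where i: "i = (s, j)" "s \<in> topspace Y" "j \<in> idx V"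
        using subsetD[OF Op_sub \<open>i \<in> Op\<close>] by (rule SigmaE)
      obtain a j1 where a: "0 < a" and j1: "j1 \<in> idx V"
        and le: "\<And>z w. z \<in> pts V \<Longrightarrow> w \<in> stalk V z \<Longrightarrow> nu V j (F z s w) \<le> a * nu V j1 w"
        using Fp i unfolding pointwise_equicontinuous_def by blast
      have "bdd_above ((\<lambda>z. nu V j1 (v z)) ` pts V)"
        using v j1 by (simp add: sections_on_at_def bounded_sections_def)
      then obtain M where M: "\<And>z. z \<in> pts V \<Longrightarrow> nu V j1 (v z) \<le> M"
        by (auto simp: bdd_above_def)
      have "nu V j (G z s) \<le> a * M" if "z \<in> pts V" for z
      proof -
        have "nu V j (F z s (v z)) \<le> a * nu V j1 (v z)"
          by (rule le[OF that sections_on_at_stalk[OF v that]])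
        also have "\<dots> \<le> a * M" using M[OF that] a by simp
        finally show ?thesis using that i by (simp add: G star_def)
      qed
      then show ?thesis using i by auto
    qed
    then obtain M where M: "\<And>i z. i \<in> Op \<Longrightarrow> z \<in> pts V \<Longrightarrow> nu V (snd i) (G z (fst i)) \<le> M i"
      by metis
    \<comment> \<open>Inserting 0 mirrors the form of \<open>nu Z Op\<close> and covers an empty
      \<open>Op\<close>.\<close>
    have "nu Z Op (G z) \<le> Max (insert 0 (M ` Op))" if z: "z \<in> pts V" for z
    proof -
      have "nu V j (G z s) \<le> Max (insert 0 (M ` Op))" if "(s, j) \<in> Op" for s j
        using M[OF that z] that fin by (auto intro: order_trans[OF _ Max_ge])
      moreover have "G z \<in> stalk Z z" using GPi z by auto
      ultimately show ?thesis using fin by (auto simp: nuZ[OF z _ Op])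
    qed
    then show ?thesis by (auto simp: bdd_above_def)
  qed
  then have Gb: "G \<in> bounded_sections Z (pts Z)"
    using GPi bZ by (simp add: bounded_sections_def)
  have "G \<in> sections_at Z x"
  proof (rule bounded_section_continuous_atI[OF Z Gb G'sec _ eq])
    show "x \<in> pts Z" using x bZ by simp
    fix Op and \<eta> :: real
    assume Op: "Op \<in> idx Z" and \<eta>: "0 < \<eta>"
    have fin: "finite Op" and Op_sub: "Op \<subseteq> topspace Y \<times> idx V" using Op idxZ by simp_all
    have "\<exists>N. openin (bas V) N \<and> x \<in> N \<and>
        (\<forall>z\<in>N. nu V (snd i) (vsub (stalk_tvs V z) (G z (fst i)) (G' z (fst i))) < \<eta>)"
      if "i \<in> Op" for i
    proof -
      obtain s j where i: "i = (s, j)" "s \<in> topspace Y" "j \<in> idx V"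
        using subsetD[OF Op_sub \<open>i \<in> Op\<close>] by (rule SigmaE)
      obtain N where N: "openin (bas V) N" "x \<in> N"
          "\<forall>z\<in>N. nu V j (vsub (stalk_tvs V z) (F z s (v z)) (F' z s (v' z))) < \<eta>"
        using pointwise_equicontinuous_star_near[OF \<Theta> x endos Fp F' v v'(2,1,3) i(2,3) \<eta>] by blast
      \<comment> \<open>Inside the base the restricted abstractions in \<open>star\<close> evaluate
        to the actual products.\<close>
      moreover have "N \<subseteq> pts V" using N(1) by (rule openin_subset)
      ultimately show ?thesis using i by (auto simp: G G'_def star_def intro!: exI[of _ N])
    qed
    then obtain N where N: "\<And>i. i \<in> Op \<Longrightarrow> openin (bas V) (N i)" "\<And>i. i \<in> Op \<Longrightarrow> x \<in> N i"
        "\<And>i z. i \<in> Op \<Longrightarrow> z \<in> N i \<Longrightarrow>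
          nu V (snd i) (vsub (stalk_tvs V z) (G z (fst i)) (G' z (fst i))) < \<eta>"
      by metis
    \<comment> \<open>Intersecting with the base keeps the set open when \<open>Op\<close> is empty,
      where the indexed intersection is the whole type.\<close>
    let ?N = "(\<Inter>i\<in>Op. N i) \<inter> pts V"
    have "openin (bas V) ?N"
      using fin N(1) by (intro openin_INT) auto
    moreover have "nu Z Op (vsub (stalk_tvs Z z) (G z) (G' z)) < \<eta>" if "z \<in> ?N" for z
    proof -
      have z: "z \<in> pts V" using that by simp
      have Gz: "G z \<in> stalk Z z" and G'z: "G' z \<in> stalk Z z"
        using GPi sections_on_stalk[OF G'sec] z bZ by auto
      have "complex_vector_space (stalk_tvs Z z)"
        using omega_bundle_complex_vector_space[OF Z] z bZ by simp
      then have D: "vsub (stalk_tvs Z z) (G z) (G' z) \<in> stalk Z z"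
        using vsub_closed[of "stalk_tvs Z z" "G z" "G' z"] Gz G'z by simp
      have "nu V j (vsub (stalk_tvs Z z) (G z) (G' z) s) < \<eta>" if "(s, j) \<in> Op" for s j
      proof -
        have "s \<in> topspace Y" using subsetD[OF Op_sub that] by simp
        then show ?thesis
          using N(3)[OF that, of z] \<open>z \<in> ?N\<close> that
          by (auto simp: mu_related_vsub_apply[OF \<mu> z Gz G'z])
      qed
      \<comment> \<open>A maximum over a finite set is below \<eta> as soon as every member is; for
        the inserted 0 this is the positivity of \<eta>.\<close>
      then show ?thesis using fin \<eta> by (auto simp: nuZ[OF z D Op])
    qed
    ultimately show "\<exists>N. openin (bas Z) N \<and> x \<in> N \<and>
        (\<forall>z\<in>N. nu Z Op (vsub (stalk_tvs Z z) (G z) (G' z)) < \<eta>)"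
      using N(2) x bZ by (intro exI[of _ ?N]) auto
  qed
  then show "G \<in> sections_diamond Z x"
    using G'sec eq by (auto simp: sections_diamond_def sections_at_through_def)
qed

end
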